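(* Let $p$ be an odd prime, $n\ge1$, $q=p^n$, let $\gamma$ be a generator of $\mathbb{F}_q^*$ (so $T=q-1$), and $G=\langle\gamma\rangle=\mathbb{F}_q^*$. Let $d:G\to\mathbb{F}_q$ be given by $d(\gamma^x)=\gamma^{x^2}$. Let $m$ be an integer with $0\le m\le T$ and $F:\mathbb{F}_q\to\mathbb{F}_q$ a map with $F(\zeta)=d(\zeta)$ for all but at most $m$ elements $\zeta\in G$. Suppose there exist an $\mathbb{F}_p$-linear subspace $U\le \mathbb{F}_q$ of codimension $k$, a linearised polynomial $M\in\mathbb{F}_q[X]$ and constants $a_V\in\mathbb{F}_q$ indexed by the cosets $V$ of $U$, such that $F(\zeta)=M(\zeta)+a_{U+\zeta}$ for all $\zeta\in\mathbb{F}_q$. If $n\not\equiv 0\pmod{\frac{p-1}{2}}$, then $p^k\ge \frac{q}{4m+1}$.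
   Context: A linearised polynomial over $\mathbb{F}_q$ is one of the form $\sum_{j=0}^{n-1}c_jX^{p^j}$, $c_j\in\mathbb{F}_q$. *)

theory Defs
  imports Complex_Main "HOL-Number_Theory.Cong" "Berlekamp_Zassenhaus.Finite_Field"
begin

text \<open>
  The prime field with \<open>p\<close> elements is the type \<open>'p mod_ring\<close> with \<open>CARD('p) = p\<close> prime; the field
  with \<open>q\<close> elements is a type \<open>'a\<close> of classes \<open>field\<close> and \<open>finite\<close>. The action below makes \<open>'a\<close> a
  vector space over \<open>'p mod_ring\<close> as soon as \<open>'a\<close> has characteristic \<open>p\<close>
  (lemma \<open>vector_space_fp_scale\<close>), so that \<open>module.subspace\<close> and \<open>vector_space.dim\<close> apply to it.
\<close>

definition fp_scale :: "'p::prime_card mod_ring \<Rightarrow> 'a::field \<Rightarrow> 'a" where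
  "fp_scale c x = of_int (to_int_mod_ring c) * x"

lemma of_int_to_int_mod_ring_of_int:
  assumes "CHAR('a::field) = CARD('p::prime_card)"
  shows "(of_int (to_int_mod_ring (of_int i :: 'p mod_ring)) :: 'a) = of_int i"
proof -
  have "to_int_mod_ring (of_int i :: 'p mod_ring) = i mod int CARD('p)"
    by (simp add: of_int_of_int_mod_ring of_int_mod_ring.rep_eq to_int_mod_ring.rep_eq)
  moreover have "(of_int (i mod int CARD('p)) :: 'a) = of_int i"
  proof -
    have "(of_int i :: 'a) = of_int (i mod int CARD('p) + int CARD('p) * (i div int CARD('p)))"
      by (simp only: mod_mult_div_eq)
    also have "\<dots> = of_int (i mod int CARD('p)) + of_nat CARD('p) * of_int (i div int CARD('p))"
      by (simp only: of_int_add of_int_mult of_int_of_nat_eq)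
    also have "(of_nat CARD('p) :: 'a) = 0"
      using assms of_nat_CHAR by metis
    finally show ?thesis by simp
  qed
  ultimately show ?thesis by simp
qed

lemma vector_space_fp_scale:
  assumes "CHAR('a::field) = CARD('p::prime_card)"
  shows "vector_space (fp_scale :: 'p mod_ring \<Rightarrow> 'a \<Rightarrow> 'a)"
proof -
  have rep: "c = of_int (to_int_mod_ring c)" for c :: "'p mod_ring"
    by (simp add: of_int_of_int_mod_ring)
  have add: "(of_int (to_int_mod_ring (b + c)) :: 'a)
      = of_int (to_int_mod_ring b) + of_int (to_int_mod_ring c)" for b c :: "'p mod_ring"
    using of_int_to_int_mod_ring_of_int[OF assms, of "to_int_mod_ring b + to_int_mod_ring c"]
    by (simp flip: rep)
  have mult: "(of_int (to_int_mod_ring (b * c)) :: 'a)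
      = of_int (to_int_mod_ring b) * of_int (to_int_mod_ring c)" for b c :: "'p mod_ring"
    using of_int_to_int_mod_ring_of_int[OF assms, of "to_int_mod_ring b * to_int_mod_ring c"]
    by (simp flip: rep)
  show ?thesis
    by unfold_locales (simp_all add: fp_scale_def add mult algebra_simps)
qed

definition linearised_poly :: "nat \<Rightarrow> nat \<Rightarrow> 'a::field poly \<Rightarrow> bool" where
  "linearised_poly p n M \<longleftrightarrow> (\<exists>c :: nat \<Rightarrow> 'a. M = (\<Sum>j<n. monom (c j) (p ^ j)))"

definition coset :: "'a::ab_group_add set \<Rightarrow> 'a \<Rightarrow> 'a set" where
  "coset U z = (\<lambda>u. u + z) ` U"

end

(* Let h = g^((q-1)/(p-1)), a generator of the multiplicative group of the prime field.  Suppose that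
   F and d agree at u, h u, h^2 u and h^3 u for some nonzero u in U.  On U, F is a linear map plus a
   constant, so F(h^t u) = A + B h^t.  On the other hand, if u = g^x then
   d(h^t u) = d(u) w^(t(t-1)/2) z^t with w = h^(2n) and z = h^(n+2x).  Eliminating A and B from the
   values at t = 0,1,2,3 and using w \<noteq> 1, which is the hypothesis on n, one finds
   h = (w z)^2.  This makes h an even power of itself, which is impossible because its order p - 1
   is even.  So the nonzero elements of U are covered by four sets of at most m elements each,
   namely the preimages of the exceptional set under multiplication by 1, h, h^2, h^3. *)
theory Submission
  imports Defs "HOL-Library.FuncSet"
begin

section \<open>Sizes of subspaces and orders of elements in a finite field\<close>

text \<open>Coordinates with respect to a basis \<open>B\<close> of \<open>U\<close> identify
  \<open>U\<close> with the scalar-valued functions on \<open>B\<close>.\<close>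

lemma card_subspace_eq_power_dim:
  fixes scale :: "'k::{field,finite} \<Rightarrow> 'v::{ab_group_add,finite} \<Rightarrow> 'v"
  assumes "vector_space scale" and "module.subspace scale U"
  shows "card U = CARD('k) ^ vector_space.dim scale U"
proof -
  interpret vector_space scale by fact
  obtain B where B: "B \<subseteq> U" "independent B" "U \<subseteq> span B" "card B = dim U"
    by (rule basis_exists)
  have fin: "finite B" by simp
  have span: "span B = U"
    using B(1,3) assms(2) span_minimal by blast
  let ?s = "\<lambda>f. \<Sum>v\<in>B. scale (f v) v"
  have "inj_on ?s (B \<rightarrow>\<^sub>E UNIV)"
  proof (rule inj_onI)
    fix f f' assume f: "f \<in> B \<rightarrow>\<^sub>E UNIV" "f' \<in> B \<rightarrow>\<^sub>E UNIV" and eq: "?s f = ?s f'"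
    have "(\<Sum>v\<in>B. scale (f v - f' v) v) = 0"
      using eq by (simp add: scale_left_diff_distrib sum_subtractf)
    then have "f v - f' v = 0" if "v \<in> B" for v
      using independentD[OF B(2) fin subset_refl, of "\<lambda>v. f v - f' v"] that by blast
    then show "f = f'"
      using f by (intro PiE_ext[of f B _ f']) auto
  qed
  moreover have "?s ` (B \<rightarrow>\<^sub>E UNIV) = U"
  proof -
    \<comment> \<open>The span ranges over all coefficient functions; restricting one to
      \<open>B\<close> leaves its sum unchanged.\<close>
    have "?s f \<in> ?s ` (B \<rightarrow>\<^sub>E UNIV)" for f
      by (rule image_eqI[of _ _ "restrict f B"]) (auto intro: sum.cong)
    then show ?thesis
      using span_finite[OF fin] span by auto
  qed
  ultimately have "card U = card (B \<rightarrow>\<^sub>E (UNIV :: 'k set))"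
    using card_image by fastforce
  then show ?thesis
    using B(4) by (simp add: card_PiE)
qed

text \<open>Multiplication by \<open>x\<close> permutes the nonzero elements, so their product,
  itself nonzero, is unchanged when multiplied by this power of \<open>x\<close>.\<close>

lemma power_card_minus_1:
  fixes x :: "'a::{field,finite}"
  assumes "x \<noteq> 0"
  shows "x ^ (CARD('a) - 1) = 1"
proof -
  have "(\<Prod>y\<in>UNIV - {0}. x * y) = (\<Prod>y\<in>UNIV - {0}. y)"
    using assms by (intro prod.reindex_bij_witness[of _ "\<lambda>y. y / x" "\<lambda>y. x * y"]) auto
  then show ?thesis
    by (simp add: prod.distrib card_Diff_singleton)
qed

text \<open>If \<open>j\<close> left a nonzero remainder r modulo \<open>T\<close>, then
  \<open>g powi r = 1\<close> and the powers of \<open>g\<close> would take at most r <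
  \<open>T\<close> values, too few to fill the multiplicative group.\<close>

lemma generator_powi_eq_1:
  fixes g :: "'a::{field,finite}"
  assumes gen: "range (\<lambda>x::int. g powi x) = UNIV - {0}" and "g powi j = 1"
  shows "int (CARD('a) - 1) dvd j"
proof -
  define T where "T = int (CARD('a) - 1)"
  have g0: "g \<noteq> 0"
    using gen by (metis Diff_iff power_int_1_right rangeI singletonI)
  have "card {0, 1 :: 'a} \<le> CARD('a)" by (rule card_mono) auto
  then have T: "T > 0" by (simp add: T_def)
  have period: "g powi x = g powi (x mod r)" if "g powi r = 1" for r x
  proof -
    have "g powi x = g powi (r * (x div r) + x mod r)" by simp
    also have "\<dots> = (g powi r) powi (x div r) * g powi (x mod r)"
      by (simp only: power_int_add[OF disjI1[OF g0]] power_int_mult)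
    finally show ?thesis using that by simp
  qed
  have "g powi T = 1"
    using power_card_minus_1[OF g0] by (simp only: T_def power_int_of_nat)
  then have r1: "g powi (j mod T) = 1"
    using period assms(2) by metis
  have "j mod T = 0"
  proof (rule ccontr)
    assume "j mod T \<noteq> 0"
    then have r: "0 < j mod T" "j mod T < T"
      using T pos_mod_sign[of T j] by (linarith, simp)
    have "UNIV - {0} \<subseteq> (\<lambda>x. g powi x) ` {0..<j mod T}"
      unfolding gen[symmetric]
    proof (rule image_subsetI)
      fix x
      show "g powi x \<in> (\<lambda>x. g powi x) ` {0..<j mod T}"
        by (rule image_eqI, rule period[OF r1]) (simp add: r(1))
    qed
    then have "card (UNIV - {0} :: 'a set) \<le> card {0..<j mod T}"
      using surj_card_le by blast
    then show False
      using r by (simp add: T_def card_Diff_singleton)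
  qed
  then show ?thesis unfolding T_def by (rule dvd_eq_mod_eq_0[THEN iffD2])
qed

section \<open>The prime field and its action on \<open>M\<close> and \<open>U\<close>\<close>

lemma CHAR_eq_if_CARD_power:
  assumes "CARD('a::{field,finite}) = p ^ n" and "prime p"
  shows "CHAR('a) = p"
proof -
  have "prime CHAR('a)"
    by (simp add: finite_imp_CHAR_pos prime_CHAR_semidom)
  moreover have "CHAR('a) dvd p ^ n"
    using CHAR_dvd_CARD[where 'a = 'a] assms(1) by simp
  ultimately show ?thesis
    using assms(2) primes_dvd_imp_eq prime_dvd_power by blast
qed

lemma of_nat_power_CHAR:
  assumes "prime CHAR('a::field)"
  shows "(of_nat i :: 'a) ^ CHAR('a) = of_nat i"
proof (induction i)
  case 0
  then show ?case using prime_gt_0_nat[OF assms] by simp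
next
  case (Suc i)
  then show ?case by (simp add: freshmans_dream[OF assms refl])
qed

text \<open>With p the characteristic, X^p - X has at most p roots, and the images of 0, ..., p-1
  already supply p of them.\<close>

lemma power_CHAR_fixed_imp_of_nat:
  fixes x :: "'a::field"
  assumes "prime CHAR('a)" and "x ^ CHAR('a) = x"
  obtains i where "x = of_nat i"
proof -
  let ?p = "CHAR('a)"
  let ?P = "monom 1 ?p - monom 1 1 :: 'a poly"
  have p: "?p > 1" using assms(1) prime_gt_1_nat by blast
  have "coeff ?P ?p = 1" using p by simp
  then have P0: "?P \<noteq> 0" by (metis coeff_0 zero_neq_one)
  have roots: "{y. poly ?P y = 0} = {y. y ^ ?p = y}"
    by (auto simp: poly_monom)
  have "degree ?P \<le> ?p"
    using p by (intro degree_diff_le degree_monom_le order_trans[OF degree_monom_le]) auto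
  then have "card {y :: 'a. y ^ ?p = y} \<le> ?p"
    using card_poly_roots_bound[OF P0] unfolding roots by simp
  moreover have "finite {y :: 'a. y ^ ?p = y}"
    using poly_roots_finite[OF P0] unfolding roots .
  moreover have "of_nat ` {..<?p} \<subseteq> {y :: 'a. y ^ ?p = y}"
    using of_nat_power_CHAR[OF assms(1)] by auto
  moreover have "inj_on (of_nat :: nat \<Rightarrow> 'a) {..<?p}"
    by (auto simp: inj_on_def of_nat_eq_iff_cong_CHAR cong_def)
  then have "card ((of_nat :: nat \<Rightarrow> 'a) ` {..<?p}) = ?p"
    by (simp add: card_image)
  ultimately have "of_nat ` {..<?p} = {y :: 'a. y ^ ?p = y}"
    using card_seteq by metis
  with assms(2) that show ?thesis by auto
qed

lemma power_power_fixed: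
  fixes x :: "'a::monoid_mult"
  assumes "x ^ p = x"
  shows "x ^ (p ^ j) = x"
proof (induction j)
  case 0
  then show ?case by simp
next
  case (Suc j)
  have "x ^ (p ^ Suc j) = (x ^ p) ^ (p ^ j)"
    by (simp only: power_Suc power_mult)
  then show ?case
    by (simp only: assms Suc)
qed

text \<open>Since \<open>h ^ p = h\<close>, iterating gives \<open>h ^ (p ^ j) = h\<close>, so
  \<open>h\<close> pulls out of every monomial of \<open>M\<close>.\<close>

lemma poly_linearised_scale:
  assumes "linearised_poly p n M" and "h ^ p = h"
  shows "poly M (h * x) = h * poly M x"
proof -
  obtain c where M: "M = (\<Sum>j<n. monom (c j) (p ^ j))"
    using assms(1) by (auto simp: linearised_poly_def)
  show ?thesis
    unfolding M poly_sum poly_monom sum_distrib_left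
    by (simp add: power_mult_distrib power_power_fixed[OF assms(2)] mult.left_commute)
qed

lemma subspace_of_nat_mult:
  assumes "CHAR('a::field) = CARD('p::prime_card)"
    and "module.subspace (fp_scale :: 'p mod_ring \<Rightarrow> 'a \<Rightarrow> 'a) U" and "x \<in> U"
  shows "of_nat i * x \<in> U"
proof -
  interpret vector_space "fp_scale :: 'p mod_ring \<Rightarrow> 'a \<Rightarrow> 'a"
    by (rule vector_space_fp_scale) fact
  have "fp_scale (of_int (int i) :: 'p mod_ring) x \<in> U"
    using assms(2,3) by (rule subspace_scale)
  then show ?thesis
    unfolding fp_scale_def of_int_to_int_mod_ring_of_int[OF assms(1)] by simp
qed

text \<open>Serves to make the term \<open>a (coset U \<zeta>)\<close> constant, equal to
  \<open>a U\<close>, for \<zeta> in \<open>U\<close>.\<close>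

lemma coset_mem_subspace:
  assumes "CHAR('a::field) = CARD('p::prime_card)"
    and "module.subspace (fp_scale :: 'p mod_ring \<Rightarrow> 'a \<Rightarrow> 'a) U" and "x \<in> U"
  shows "coset U x = U"
proof -
  interpret vector_space "fp_scale :: 'p mod_ring \<Rightarrow> 'a \<Rightarrow> 'a"
    by (rule vector_space_fp_scale) fact
  have "y \<in> (\<lambda>u. u + x) ` U" if "y \<in> U" for y
    using subspace_diff[OF assms(2) that assms(3)] by (intro image_eqI[of _ _ "y - x"]) auto
  then show ?thesis
    using subspace_add[OF assms(2) _ assms(3)] by (auto simp: coset_def)
qed

section \<open>Elimination of the affine coefficients, and geometric sums\<close>

text \<open>The values s(t) = A + B h^t obey s(t+2) = (1+h) s(t+1) - h s(t). At t = 0 this is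
  \<open>r1\<close>; at t = 1, after division by \<open>z\<close>, it is \<open>r2\<close>.\<close>

lemma geometric_eliminate:
  fixes h w z A B :: "'a::field"
  assumes "1 = A + B" "z = A + B * h" "w * z^2 = A + B * h^2" "w^3 * z^3 = A + B * h^3"
    and "z \<noteq> 0" "w \<noteq> 1"
  shows "h = (w * z)^2"
proof -
  have r1: "w * z^2 - (1 + h) * z + h = 0"
  proof -
    have "w * z^2 - (1 + h) * z + h = h * (1 - (A + B))"
      unfolding assms(3) unfolding assms(2) by (simp add: algebra_simps power2_eq_square)
    then show ?thesis using assms(1) by simp
  qed
  have "z * (w^3 * z^2 - (1 + h) * (w * z) + h) = w^3 * z^3 - (1 + h) * (w * z^2) + h * z"
    by (simp add: algebra_simps power2_eq_square power3_eq_cube)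
  also have "\<dots> = 0"
    unfolding assms(3,4) unfolding assms(2)
    by (simp add: algebra_simps power2_eq_square power3_eq_cube)
  finally have "z * (w^3 * z^2 - (1 + h) * (w * z) + h) = 0" .
  with assms(5) have r2: "w^3 * z^2 - (1 + h) * (w * z) + h = 0" by simp
  \<comment> \<open>Subtracting the relations removes the constant term \<open>h\<close> and exposes
    the factor \<open>w - 1\<close>.\<close>
  have "z * (w - 1) * (w * (w + 1) * z - (1 + h))
      = (w^3 * z^2 - (1 + h) * (w * z) + h) - (w * z^2 - (1 + h) * z + h)"
    by (simp add: algebra_simps power2_eq_square power3_eq_cube)
  then have "z * (w - 1) * (w * (w + 1) * z - (1 + h)) = 0"
    unfolding r1 r2 by simp
  with assms(5,6) have h1: "1 + h = w * (w + 1) * z" by simp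
  \<comment> \<open>Solve \<open>r1\<close> for its constant term; inserting \<open>h1\<close>
    leaves w(w+1)z^2 - wz^2.\<close>
  have "h = (1 + h) * z - w * z^2"
    using r1 by (simp add: algebra_simps)
  also have "\<dots> = (w * z)^2"
    unfolding h1 by (simp add: algebra_simps power2_eq_square)
  finally show ?thesis .
qed

text \<open>Every power of \<open>p\<close> is 1 modulo \<open>p - 1\<close>. This transfers the
  hypothesis on \<open>n\<close> to the exponent (q-1)/(p-1).\<close>

lemma geometric_sum_nat_cong:
  assumes "p \<ge> 1"
  shows "[(\<Sum>i<n. p ^ i) = n] (mod (p - 1 :: nat))"
proof -
  have "[p = 1] (mod (p - 1))"
    using assms by (metis cong_def le_add_diff_inverse mod_add_self2)
  then have "[(\<Sum>i<n. p ^ i) = (\<Sum>i<n. 1)] (mod (p - 1))"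
    by (intro cong_sum) (metis cong_pow power_one)
  then show ?thesis by simp
qed

lemma geometric_sum_nat:
  assumes "p \<ge> 1"
  shows "(\<Sum>i<n. p ^ i) * (p - 1) = p ^ n - (1 :: nat)"
proof -
  have "int ((\<Sum>i<n. p ^ i) * (p - 1)) = int p ^ n - 1"
    using assms by (simp add: power_diff_1_eq of_nat_diff)
  also have "\<dots> = int (p ^ n - 1)"
    using assms by (simp add: of_nat_diff)
  finally show ?thesis
    by (simp only: of_nat_eq_iff)
qed

section \<open>Exceptional points among four prime-field multiples, and the resulting bound\<close>

theorem theorem3p4:
  fixes p n q m k :: nat
    and g :: "'a :: {field, finite}"
    and G U :: "'a set"
    and d F :: "'a \<Rightarrow> 'a"
    and M :: "'a poly"
    and a :: "'a set \<Rightarrow> 'a"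
  assumes "p = CARD('p :: prime_card)" and "odd p"
    and "n \<ge> 1" and "q = p ^ n" and "CARD('a) = q"
    and "G = range (\<lambda>x::int. g powi x)" and "G = UNIV - {0}"
    and "\<forall>x::int. d (g powi x) = g powi (x\<^sup>2)"
    and "m \<le> q - 1"
    and "card {\<zeta> \<in> G. F \<zeta> \<noteq> d \<zeta>} \<le> m"
    and "module.subspace (fp_scale :: 'p mod_ring \<Rightarrow> 'a \<Rightarrow> 'a) U"
    and "vector_space.dim (fp_scale :: 'p mod_ring \<Rightarrow> 'a \<Rightarrow> 'a) UNIV
           = vector_space.dim (fp_scale :: 'p mod_ring \<Rightarrow> 'a \<Rightarrow> 'a) U + k"
    and "linearised_poly p n M"
    and "\<forall>\<zeta>. F \<zeta> = poly M \<zeta> + a (coset U \<zeta>)"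
    and "\<not> [n = 0] (mod (p - 1) div 2)"
  shows "real (p ^ k) \<ge> real q / (4 * real m + 1)"
proof -
  have p: "prime p"
    using assms(1) prime_card by simp
  have p3: "p \<ge> 3"
    using \<open>odd p\<close> prime_ge_2_nat[OF p] by (cases "p = 2") auto
  have char: "CHAR('a) = CARD('p)"
    using CHAR_eq_if_CARD_power[of p n] assms(1,4,5) p by simp
  have gen: "range (\<lambda>x::int. g powi x) = UNIV - {0}"
    using assms(6,7) by simp
  have g0: "g \<noteq> 0"
    using gen by (metis Diff_iff power_int_1_right rangeI singletonI)
  define N where "N = (\<Sum>i<n. p ^ i)"
  have N: "N * (p - 1) = q - 1"
    using geometric_sum_nat[of p n] p3 \<open>q = p ^ n\<close> by (simp add: N_def)
  have N0: "N > 0"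
    using p3 \<open>n \<ge> 1\<close> unfolding N_def by (intro sum_pos) (auto simp: lessThan_empty_iff)
  define h where "h = g ^ N"
  have h0: "h \<noteq> 0" using g0 by (simp add: h_def)
  have h_powi: "h powi j = g powi (int N * j)" for j
    by (simp add: h_def power_int_power)
  \<comment> \<open>Here q - 1 = N(p-1) divides Nj, and \<open>N\<close> cancels.\<close>
  have h_order: "int (p - 1) dvd j" if "h powi j = 1" for j
  proof -
    have "int N * int (p - 1) dvd int N * j"
      using generator_powi_eq_1[OF gen] that N unfolding h_powi assms(5) by (metis of_nat_mult)
    then show ?thesis using N0 by simp
  qed
  \<comment> \<open>The aim is \<open>h ^ p = h\<close>, which puts the powers of \<open>h\<close>
    in the prime field: they preserve \<open>U\<close> and pull out of \<open>M\<close>.\<close>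
  have "h ^ (p - 1) = 1"
    using power_card_minus_1[OF g0] N unfolding h_def assms(5) by (simp flip: power_mult)
  then have "h ^ p = h"
    using p3 by (metis One_nat_def Suc_pred mult.right_neutral not_numeral_le_zero not_gr_zero power_Suc)
  then have ht: "(h ^ t) ^ p = h ^ t" for t
    by (metis mult.commute power_mult)
  have ht_U: "h ^ t * u \<in> U" if "u \<in> U" for t u
    using power_CHAR_fixed_imp_of_nat[of "h ^ t"] ht[of t] char assms(1) p
      subspace_of_nat_mult[OF char assms(11) that] by metis
  \<comment> \<open>\<open>N\<close> stands in for \<open>n\<close> in the exponents of
    \<open>w\<close> and \<open>z\<close>: they agree modulo \<open>p - 1\<close>, and
    \<open>h ^ (p - 1) = 1\<close>.\<close>
  define w where "w = h powi (2 * int N)"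
  have w1: "w \<noteq> 1"
  proof
    assume "w = 1"
    then have "int (p - 1) dvd int (2 * N)"
      using h_order by (simp add: w_def)
    then have "p - 1 dvd 2 * N"
      by (simp only: of_nat_dvd_iff)
    then have "p - 1 dvd 2 * n"
      using cong_scalar_left[OF geometric_sum_nat_cong[of p n], of 2] p3
      by (simp add: N_def cong_def dvd_eq_mod_eq_0)
    moreover have "p - 1 = 2 * ((p - 1) div 2)"
      using \<open>odd p\<close> by simp
    ultimately have "2 * ((p - 1) div 2) dvd 2 * n"
      by (rule back_subst[where P = "\<lambda>r. r dvd 2 * n"])
    then have "(p - 1) div 2 dvd n"
      by simp
    then show False
      using assms(15) by (simp add: cong_0_iff)
  qed
  let ?bad = "{\<zeta> \<in> G. F \<zeta> \<noteq> d \<zeta>}"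
  have four: "\<exists>t<4. h ^ t * u \<in> ?bad" if u: "u \<in> U" "u \<noteq> 0" for u
  proof (rule ccontr)
    assume not_bad: "\<not> ?thesis"
    obtain x :: int where x: "u = g powi x"
      using gen u(2) by blast
    \<comment> \<open>\<open>D\<close> is the value of \<open>d\<close> at \<open>u\<close>;
      dividing by it normalises the value at t = 0 to 1.\<close>
    define D where "D = g powi (x\<^sup>2)"
    have D0: "D \<noteq> 0" using g0 by (simp add: D_def)
    define A where "A = a U / D"
    define B where "B = poly M u / D"
    have eq: "h powi (2 * x * int t + (int t)\<^sup>2 * int N) = A + B * h ^ t" if "t < 4" for t
    proof -
      have "h ^ t * u \<in> G" using assms(7) h0 u(2) by simp
      then have good: "F (h ^ t * u) = d (h ^ t * u)"
        using not_bad that by blast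
      have "h ^ t * u = g powi (x + int t * int N)"
          using g0 h_powi[of "int t"] by (simp add: x power_int_add mult.commute)
      then have "d (h ^ t * u) = g powi ((x + int t * int N)\<^sup>2)"
        using assms(8) by simp
      \<comment> \<open>Beyond x^2 every term of the exponent contains \<open>N\<close>, so the rest
        is a power of \<open>h\<close>.\<close>
      also have "(x + int t * int N)\<^sup>2
          = x\<^sup>2 + int N * (2 * x * int t + (int t)\<^sup>2 * int N)"
        by (simp add: power2_eq_square algebra_simps)
      also have "g powi \<dots> = D * h powi (2 * x * int t + (int t)\<^sup>2 * int N)"
        using g0 by (simp add: power_int_add D_def h_powi)
      finally have "D * h powi (2 * x * int t + (int t)\<^sup>2 * int N) = F (h ^ t * u)"
        using good by simp
      also have "\<dots> = h ^ t * poly M u + a U"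
        using assms(14) poly_linearised_scale[OF assms(13) ht]
          coset_mem_subspace[OF char assms(11) ht_U[OF u(1)]] by simp
      finally show ?thesis
        using D0 by (simp add: A_def B_def field_simps)
    qed
    define z where "z = h powi (2 * x + int N)"
    have z0: "z \<noteq> 0" using h0 by (simp add: z_def)
    \<comment> \<open>For i = t(t-1)/2 and j = t the exponent is Nt(t-1) + (2x+N)t = 2xt + Nt^2, as
      in \<open>eq\<close>.\<close>
    have wz: "w ^ i * z ^ j = h powi (2 * int N * int i + (2 * x + int N) * int j)" for i j
      by (simp only: w_def z_def power_int_power' power_int_add[OF disjI1[OF h0], symmetric])
    have "h = (w * z)\<^sup>2"
    proof (rule geometric_eliminate)
      show "1 = A + B" using eq[of 0] by simp
      show "z = A + B * h" using eq[of 1] by (simp add: z_def)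
      have "w ^ 1 * z\<^sup>2 = h powi (2 * x * int 2 + (int 2)\<^sup>2 * int N)"
        unfolding wz by (rule arg_cong[where f = "power_int h"]) simp
      from trans[OF this eq] show "w * z\<^sup>2 = A + B * h\<^sup>2" by simp
      have "w ^ 3 * z ^ 3 = h powi (2 * x * int 3 + (int 3)\<^sup>2 * int N)"
        unfolding wz by (rule arg_cong[where f = "power_int h"]) simp
      from trans[OF this eq] show "w ^ 3 * z ^ 3 = A + B * h ^ 3" by simp
    qed (fact z0 w1)+
    also have "\<dots> = h powi (2 * (3 * int N + 2 * x))"
      unfolding power_mult_distrib wz by (rule arg_cong[where f = "power_int h"]) simp
    \<comment> \<open>Dividing by \<open>h\<close> leaves an odd exponent with value 1, against the
      evenness of \<open>p - 1\<close>.\<close>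
    finally have "h powi (2 * (3 * int N + 2 * x) - 1) = h / h powi 1"
      by (simp only: power_int_diff[OF disjI1[OF h0]])
    then have "int (p - 1) dvd 2 * (3 * int N + 2 * x) - 1"
      using h0 by (intro h_order) simp
    moreover have "even (int (p - 1))" using \<open>odd p\<close> by simp
    ultimately have "even (2 * (3 * int N + 2 * x) - 1)"
      by (rule dvd_trans[rotated])
    then show False by simp
  qed
  \<comment> \<open>Each nonzero \<open>u\<close> is recovered as v / h^t from an exceptional v =
    h^t u.\<close>
  have "U - {0} \<subseteq> (\<Union>t<4. (\<lambda>v. v / h ^ t) ` ?bad)"
    using four h0 by (force simp: image_iff)
  then have "card (U - {0}) \<le> card (\<Union>t<4::nat. (\<lambda>v. v / h ^ t) ` ?bad)"
    by (intro card_mono) auto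
  also have "\<dots> \<le> (\<Sum>t<4::nat. card ((\<lambda>v. v / h ^ t) ` ?bad))"
    by (rule card_UN_le) simp
  also have "\<dots> \<le> (\<Sum>t<4::nat. m)"
    using assms(10) by (intro sum_mono order_trans[OF card_image_le]) auto
  \<comment> \<open>The extra 1 accounts for zero, which the covering omits.\<close>
  finally have U: "card U \<le> 4 * m + 1"
    using card_Diff1_le[of U 0] card_Suc_Diff1[of U 0] by (cases "0 \<in> U") auto
  have vs: "vector_space (fp_scale :: 'p mod_ring \<Rightarrow> 'a \<Rightarrow> 'a)"
    by (rule vector_space_fp_scale[OF char])
  then interpret vector_space "fp_scale :: 'p mod_ring \<Rightarrow> 'a \<Rightarrow> 'a" .
  \<comment> \<open>Counting the whole field and \<open>U\<close> by dimension turns the codimension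
    \<open>k\<close> into the index p^k.\<close>
  have "q = card U * p ^ k"
    using card_subspace_eq_power_dim[OF vs assms(11)]
      card_subspace_eq_power_dim[OF vs subspace_UNIV] assms(1,5,12)
    by (simp add: power_add)
  also have "\<dots> \<le> (4 * m + 1) * p ^ k"
    using U by (rule mult_le_mono1)
  finally have "real q \<le> real ((4 * m + 1) * p ^ k)"
    by (simp only: of_nat_le_iff)
  then show ?thesis
    by (simp add: divide_le_eq algebra_simps)
qed

end
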